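(* Let $k$ be a field and $n\ge 3$. Every (not necessarily finite-dimensional) representation of the quiver $Q(n)$ over $k$ is isomorphic to a direct sum of a representation belonging to $\check{\mathcal B}$ and of thin representations.
   Context: For $n\ge 3$, $Q(n)$ is the quiver with vertices $1,\dots,n$ and arrows $\pi_1: 3\to 1$, $\pi_2: 3\to 2$, and $i+1\to i$ for $3\le i\le n-1$. Representations consist of $k$-vector spaces (possibly infinite-dimensional) at the vertices and linear maps at the arrows; the maps of a representation $M$ at the arrows $\pi_1,\pi_2$ are again denoted $\pi_1: M_3\to M_1$ and $\pi_2: M_3\to M_2$. $\check{\mathcal B}$ is the full subcategory of all representations $M$ of $Q(n)$ such that the map $\begin{bmatrix}\pi_1\\ \pi_2\end{bmatrix}: M_3\to M_1\oplus M_2$ is bijective. A representation $M$ is thin if $\dim_k M_x\le 1$ for all vertices $x$. Direct sums may be infinite. *)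

theory Defs
  imports Complex_Main "HOL-Library.Function_Algebras"
begin

text \<open>
  The quiver \<open>Q(n)\<close> has no parallel arrows, so an arrow is encoded as the pair (source, target);
  \<open>\<pi>\<^sub>1\<close> is \<open>(3, 1)\<close> and \<open>\<pi>\<^sub>2\<close> is \<open>(3, 2)\<close>.
\<close>

definition Q_vertices :: "nat \<Rightarrow> nat set" where
  "Q_vertices n = {1..n}"

definition Q_arrows :: "nat \<Rightarrow> (nat \<times> nat) set" where
  "Q_arrows n = {(3, 1), (3, 2)} \<union> {(i + 1, i) | i. 3 \<le> i \<and> i \<le> n - 1}"

definition linear_on ::
  "('k::field \<Rightarrow> 'v::ab_group_add \<Rightarrow> 'v) \<Rightarrow> ('k \<Rightarrow> 'w::ab_group_add \<Rightarrow> 'w) \<Rightarrow>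
    'v set \<Rightarrow> 'w set \<Rightarrow> ('v \<Rightarrow> 'w) \<Rightarrow> bool" where
  "linear_on s1 s2 U W f \<longleftrightarrow>
     (\<forall>u\<in>U. f u \<in> W) \<and>
     (\<forall>u\<in>U. \<forall>v\<in>U. f (u + v) = f u + f v) \<and>
     (\<forall>c. \<forall>u\<in>U. f (s1 c u) = s2 c (f u))"

text \<open>
  The spaces of a representation are linear subspaces, of any dimension, of one ambient
  \<open>k\<close>-vector space given by a type \<open>'v\<close> and a scalar multiplication. This is no restriction: any
  family of vector spaces embeds into their direct sum. The spaces at different vertices need not
  be independent or distinct in the ambient space. Values at non-vertices, and values of the
  structure maps outside the spaces, are irrelevant.
\<close>

record 'v rep =
  vspace :: "nat \<Rightarrow> 'v set"
  arrow_map :: "nat \<times> nat \<Rightarrow> 'v \<Rightarrow> 'v"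

definition is_rep ::
  "('k::field \<Rightarrow> 'v::ab_group_add \<Rightarrow> 'v) \<Rightarrow> nat \<Rightarrow> 'v rep \<Rightarrow> bool" where
  "is_rep scale n M \<longleftrightarrow>
     vector_space scale \<and>
     (\<forall>x\<in>Q_vertices n. module.subspace scale (vspace M x)) \<and>
     (\<forall>(s, t)\<in>Q_arrows n. linear_on scale scale (vspace M s) (vspace M t) (arrow_map M (s, t)))"

definition rep_isomorphic ::
  "('k::field \<Rightarrow> 'v::ab_group_add \<Rightarrow> 'v) \<Rightarrow> ('k \<Rightarrow> 'w::ab_group_add \<Rightarrow> 'w) \<Rightarrow> nat \<Rightarrow>
    'v rep \<Rightarrow> 'w rep \<Rightarrow> bool" where
  "rep_isomorphic s1 s2 n M N \<longleftrightarrow>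
     (\<exists>h :: nat \<Rightarrow> 'v \<Rightarrow> 'w.
        (\<forall>x\<in>Q_vertices n. linear_on s1 s2 (vspace M x) (vspace N x) (h x) \<and>
                          bij_betw (h x) (vspace M x) (vspace N x)) \<and>
        (\<forall>(s, t)\<in>Q_arrows n. \<forall>v\<in>vspace M s.
            h t (arrow_map M (s, t) v) = arrow_map N (s, t) (h s v)))"

definition in_B_check :: "('k::field \<Rightarrow> 'v::ab_group_add \<Rightarrow> 'v) \<Rightarrow> nat \<Rightarrow> 'v rep \<Rightarrow> bool" where
  "in_B_check scale n M \<longleftrightarrow>
     is_rep scale n M \<and>
     bij_betw (\<lambda>v. (arrow_map M (3, 1) v, arrow_map M (3, 2) v))
       (vspace M 3) (vspace M 1 \<times> vspace M 2)"

text \<open>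
  \<open>vector_space.dim\<close> is \<open>0\<close> on infinite-dimensional spaces, so dimension at most one is expressed
  through the cardinality of a finite basis.
\<close>

definition thin :: "('k::field \<Rightarrow> 'v::ab_group_add \<Rightarrow> 'v) \<Rightarrow> nat \<Rightarrow> 'v rep \<Rightarrow> bool" where
  "thin scale n M \<longleftrightarrow>
     is_rep scale n M \<and>
     (\<forall>x\<in>Q_vertices n. \<exists>B. finite B \<and> card B \<le> 1 \<and>
        \<not> module.dependent scale B \<and> module.span scale B = vspace M x)"

text \<open>
  The external direct sum of the family \<open>N j\<close>, \<open>j \<in> J\<close>, consists of the finitely supported
  families; these are functions on the whole index type that vanish outside \<open>J\<close>.
\<close>

definition direct_sum_scale :: "('k \<Rightarrow> 'v \<Rightarrow> 'v) \<Rightarrow> 'k \<Rightarrow> ('j \<Rightarrow> 'v) \<Rightarrow> 'j \<Rightarrow> 'v" where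
  "direct_sum_scale scale c f = (\<lambda>j. scale c (f j))"

definition direct_sum :: "'j set \<Rightarrow> ('j \<Rightarrow> 'v::ab_group_add rep) \<Rightarrow> ('j \<Rightarrow> 'v) rep" where
  "direct_sum J N =
     \<lparr>vspace = (\<lambda>x. {f. (\<forall>j\<in>J. f j \<in> vspace (N j) x) \<and> (\<forall>j. j \<notin> J \<longrightarrow> f j = 0) \<and>
                       finite {j. f j \<noteq> 0}}),
      arrow_map = (\<lambda>a f j. if j \<in> J then arrow_map (N j) a (f j) else 0)\<rparr>"

lemma vector_space_direct_sum_scale:
  assumes "vector_space scale"
  shows "vector_space (direct_sum_scale scale)"
proof -
  interpret vector_space scale by fact
  show ?thesis
    by unfold_locales
      (auto simp: direct_sum_scale_def fun_eq_iff scale_right_distrib scale_left_distrib)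
qed

lemma is_rep_direct_sum:
  fixes scale :: "'k::field \<Rightarrow> 'v::ab_group_add \<Rightarrow> 'v" and N :: "'j \<Rightarrow> 'v rep"
  assumes n: "n \<ge> 3" and vs: "vector_space scale"
    and N: "\<And>j. j \<in> J \<Longrightarrow> is_rep scale n (N j)"
  shows "is_rep (direct_sum_scale scale) n (direct_sum J N)"
proof -
  interpret vector_space scale by fact
  interpret D: vector_space "direct_sum_scale scale :: _ \<Rightarrow> ('j \<Rightarrow> _) \<Rightarrow> _"
    by (rule vector_space_direct_sum_scale) fact
  have sub: "subspace (vspace (N j) x)" if "j \<in> J" "x \<in> Q_vertices n" for j x
    using N[OF that(1)] that(2) by (auto simp: is_rep_def)
  have fin_add: "finite {j. f j + g j \<noteq> 0}"
    if "finite {j. f j \<noteq> 0}" "finite {j. g j \<noteq> 0}" for f g :: "'j \<Rightarrow> 'v"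
    by (rule finite_subset[OF _ finite_UnI[OF that]]) auto
  have fin_scale: "finite {j. scale c (f j) \<noteq> 0}" if "finite {j. f j \<noteq> 0}" for c and f :: "'j \<Rightarrow> 'v"
    by (rule finite_subset[OF _ that]) auto
  have "D.subspace (vspace (direct_sum J N) x)" if "x \<in> Q_vertices n" for x
    unfolding D.subspace_def direct_sum_def
    using sub[OF _ that]
    by (auto simp: direct_sum_scale_def fin_add fin_scale subspace_0 subspace_add subspace_scale)
  moreover have "linear_on (direct_sum_scale scale) (direct_sum_scale scale)
      (vspace (direct_sum J N) s) (vspace (direct_sum J N) t) (arrow_map (direct_sum J N) (s, t))"
    if a: "(s, t) \<in> Q_arrows n" for s t
  proof -
    have lin: "linear_on scale scale (vspace (N j) s) (vspace (N j) t) (arrow_map (N j) (s, t))"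
      if "j \<in> J" for j
      using N[OF that] a by (auto simp: is_rep_def)
    have s: "s \<in> Q_vertices n"
      using a n by (auto simp: Q_arrows_def Q_vertices_def)
    have zero: "arrow_map (N j) (s, t) 0 = 0" if "j \<in> J" for j
    proof -
      have "arrow_map (N j) (s, t) (scale 0 0) = scale 0 (arrow_map (N j) (s, t) 0)"
        using lin[OF that] subspace_0[OF sub[OF that s]] unfolding linear_on_def by blast
      then show ?thesis by simp
    qed
    have fin: "finite {j. (j \<in> J \<longrightarrow> arrow_map (N j) (s, t) (f j) \<noteq> 0) \<and> j \<in> J}"
      if "finite {j. f j \<noteq> 0}" for f
      by (rule finite_subset[OF _ that]) (use zero in force)
    show ?thesis
      using lin fin
      by (auto simp: linear_on_def direct_sum_def direct_sum_scale_def fun_eq_iff)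
  qed
  ultimately show ?thesis
    by (auto simp: is_rep_def D.vector_space_axioms)
qed

end

theory Submission
  imports Defs
begin

text \<open>
  Write \<open>K\<^sub>1\<close>, \<open>K\<^sub>2\<close> for the kernels of \<open>\<pi>\<^sub>1\<close>, \<open>\<pi>\<^sub>2\<close> on \<open>M\<^sub>3\<close>, and put \<open>X = K\<^sub>1 \<inter> K\<^sub>2\<close> and
  \<open>L = K\<^sub>1 + K\<^sub>2\<close>. If \<open>A\<close> is a complement of \<open>X\<close> in \<open>L\<close>, then \<open>(\<pi>\<^sub>1, \<pi>\<^sub>2)\<close> maps \<open>A\<close> bijectively onto
  \<open>\<pi>\<^sub>1(L) \<times> \<pi>\<^sub>2(L)\<close>: it is injective because \<open>A \<inter> X = 0\<close>, and \<open>(\<pi>\<^sub>1 u, \<pi>\<^sub>2 v)\<close> is the image of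
  \<open>u\<^sub>2 + v\<^sub>1\<close>, where \<open>u\<^sub>2\<close> is the \<open>K\<^sub>2\<close>-part of \<open>u\<close> and \<open>v\<^sub>1\<close> the \<open>K\<^sub>1\<close>-part of \<open>v\<close>
  (\<open>bij_betw_kernel_sum_complement\<close>). So \<open>A\<close> carries the summand in the bijective class. On the rest
  of \<open>M\<^sub>3\<close> the two maps need not be separated: both vanish on \<open>X\<close>, and on a complement of \<open>L\<close> both
  are injective, even modulo \<open>\<pi>\<^sub>1(L)\<close> and \<open>\<pi>\<^sub>2(L)\<close>.

  To split the whole representation along this division of \<open>M\<^sub>3\<close>, choose a basis of every \<open>M\<^sub>i\<close>, such
  that the arrows of the chain \<open>n \<rightarrow> \<dots> \<rightarrow> 3\<close> send basis vectors to basis vectors or to \<open>0\<close>, without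
  identifying two of them. This is possible even with bases adapted to a filtration: pull
  \<open>0 \<subseteq> X \<subseteq> L \<subseteq> M\<^sub>3\<close> back along the chain and add \<open>0\<close> at each vertex, so that the filtration of \<open>M\<^sub>i\<close>
  also contains the kernels of all the composite maps from \<open>M\<^sub>i\<close> along the chain. Every step of the
  filtration of \<open>M\<^sub>i\<^sub>+\<^sub>1\<close> above \<open>0\<close> is the full preimage of a step for \<open>M\<^sub>i\<close>; hence the nonzero images
  of an adapted basis of \<open>M\<^sub>i\<^sub>+\<^sub>1\<close> are independent and again adapted, and they extend to an adapted
  basis of \<open>M\<^sub>i\<close> (\<open>chain_basis\<close>). No dimension is counted, so infinite dimension is harmless. At the
  vertices \<open>1\<close> and \<open>2\<close> one extends the images of the basis vectors outside \<open>L\<close> in the same way, now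
  adapted to \<open>\<pi>\<^sub>1(L)\<close> and \<open>\<pi>\<^sub>2(L)\<close> (\<open>sink_basis\<close>).

  Every basis vector is finally labelled by the summand that it belongs to: \<open>None\<close> if its image in
  \<open>M\<^sub>3\<close> lies in \<open>L\<close> but not in \<open>X\<close>, or if it lies in \<open>\<pi>\<^sub>1(L)\<close> or \<open>\<pi>\<^sub>2(L)\<close>; otherwise the vertex and the
  basis vector at which its orbit under the arrows starts (\<open>labelled_basis_exists\<close>). Arrows respect
  labels, so the vectors of one label span a subrepresentation and the representation is the direct
  sum of these (\<open>direct_sum_of_labelled_basis\<close>). An orbit has at most one vector at each vertex, so
  its span is thin.
\<close>

section \<open>Bases adapted to filtrations\<close>

text \<open>
  Labels are pairs of a vertex and a vector, the start of an orbit. A vector outside the image starts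
  its own orbit at \<open>x\<close>; since no older label has first component \<open>x\<close>, injectivity survives.
\<close>

lemma transport_labels:
  fixes f :: "'a \<Rightarrow> 'b" and l :: "'a \<Rightarrow> 'i \<times> 'b"
  assumes f: "inj_on f A" and l: "inj_on l A" and x: "\<And>a. a \<in> A \<Longrightarrow> fst (l a) \<noteq> x"
  obtains l' where "inj l'" "\<And>a. a \<in> A \<Longrightarrow> l' (f a) = l a"
    "range (fst \<circ> l') \<subseteq> insert x (range (fst \<circ> l))"
proof
  define l' where "l' e = (if e \<in> f ` A then l (the_inv_into A f e) else (x, e))" for e
  show old: "l' (f a) = l a" if "a \<in> A" for a
    using that the_inv_into_f_f[OF f that] by (simp add: l'_def)
  have new: "l' e = (x, e)" if "e \<notin> f ` A" for e
    using that by (simp add: l'_def)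
  show "inj l'"
  proof (rule injI)
    fix e e' assume eq: "l' e = l' e'"
    consider a a' where "a \<in> A" "a' \<in> A" "e = f a" "e' = f a'"
      | a where "a \<in> A" "e = f a" "e' \<notin> f ` A" | a where "a \<in> A" "e' = f a" "e \<notin> f ` A"
      | "e \<notin> f ` A" "e' \<notin> f ` A"
      by blast
    then show "e = e'"
    proof cases
      case 1
      then show ?thesis using eq l by (simp add: old inj_on_eq_iff)
    next
      case 2
      then show ?thesis using eq x[of a] by (simp add: old new)
    next
      case 3
      then have "l a = (x, e)" using eq by (simp add: old new)
      then show ?thesis using x[OF \<open>a \<in> A\<close>] by simp
    next
      case 4
      then show ?thesis using eq by (simp add: new)
    qed
  qed
  show "range (fst \<circ> l') \<subseteq> insert x (range (fst \<circ> l))"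
    by (auto simp: l'_def)
qed

text \<open>
  The shift by one in the second argument inserts \<open>0\<close> at the bottom of each filtration. The preimage
  of that \<open>0\<close> is the kernel of the next map, so after \<open>k\<close> pullbacks the filtration contains the
  kernels of all composite maps out of \<open>U k\<close>.
\<close>

fun pullback_filtration ::
  "(nat \<Rightarrow> 'v set) \<Rightarrow> (nat \<Rightarrow> 'v \<Rightarrow> 'v) \<Rightarrow> (nat \<Rightarrow> 'v::zero set) \<Rightarrow> nat \<Rightarrow> nat \<Rightarrow> 'v set" where
  "pullback_filtration U f V 0 j = V j"
| "pullback_filtration U f V (Suc k) 0 = {0}"
| "pullback_filtration U f V (Suc k) (Suc j) = {v \<in> U (Suc k). f k v \<in> pullback_filtration U f V k j}"

context vector_space
begin

lemma span_Int_disjoint_independent: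
  assumes ind: "independent (A \<union> B)" and disj: "A \<inter> B = {}"
  shows "span A \<inter> span B \<subseteq> {0}"
proof
  fix v assume "v \<in> span A \<inter> span B"
  then have v: "v \<in> span A" "v \<in> span B" by auto
  have "representation (A \<union> B) v = representation A v" "representation (A \<union> B) v = representation B v"
    using ind v by (auto intro!: representation_extend)
  then have "representation A v b = 0" for b
    using representation_ne_zero[of A v b] representation_ne_zero[of B v b] disj by auto
  moreover have "independent A"
    by (rule independent_mono[OF ind]) auto
  ultimately have "v = 0"
    using sum_nonzero_representation_eq[of A v] v by simp
  then show "v \<in> {0}" by simp
qed

lemma independent_Un_span_Int:
  assumes A: "independent A" and B: "independent B" and AB: "span A \<inter> span B \<subseteq> {0}"
  shows "independent (A \<union> B)"
proof -
  have key: "a \<notin> span ((A \<union> B) - {a})"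
    if "a \<in> A" "independent A" "span A \<inter> span B \<subseteq> {0}" for a A B
  proof
    assume "a \<in> span ((A \<union> B) - {a})"
    then have "a \<in> span ((A - {a}) \<union> B)"
      using span_mono[of "(A \<union> B) - {a}" "(A - {a}) \<union> B"] by blast
    then obtain x y where a: "a = x + y" and x: "x \<in> span (A - {a})" and y: "y \<in> span B"
      unfolding span_Un by blast
    have "x \<in> span A"
      using x span_mono[of "A - {a}" A] by blast
    then have "a - x \<in> span A"
      using that(1) by (simp add: span_diff span_base)
    then have "y = 0"
      using a y that(3) by auto
    then have "a \<in> span (A - {a})"
      using a x by simp
    then show False
      using that(1,2) unfolding dependent_def by blast
  qed
  have "a \<notin> span ((A \<union> B) - {a})" if "a \<in> A \<union> B" for a
    using that
  proof
    assume "a \<in> A" then show ?thesis by (rule key) fact+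
  next
    assume "a \<in> B" then have "a \<notin> span ((B \<union> A) - {a})"
      by (rule key) (use B AB in auto)
    then show ?thesis by (simp add: Un_commute)
  qed
  then show ?thesis by (auto simp: dependent_def)
qed

text \<open>
  Structure maps are linear only on their source space; a globally linear extension makes the
  library of linear maps applicable to them.
\<close>

lemma linear_on_extension:
  assumes f: "linear_on scale scale U W f" and U: "subspace U"
  obtains g where "Vector_Spaces.linear scale scale g" "\<And>u. u \<in> U \<Longrightarrow> g u = f u"
proof -
  interpret vector_space_pair scale scale by unfold_locales
  obtain B where B: "B \<subseteq> U" "independent B" "U \<subseteq> span B"
    by (rule maximal_independent_subset)
  have lin: "Vector_Spaces.linear scale scale (construct B f)"
    by (rule linear_construct) fact
  have f0: "f 0 = 0"
    using f subspace_0[OF U] unfolding linear_on_def by (metis scale_zero_left)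
  have spanB: "span B = U"
    using B U by (metis span_subspace)
  have "u \<in> U \<and> construct B f u = f u" if "u \<in> span B" for u
    using that
  proof (induction rule: span_induct_alt)
    case base
    then show ?case using linear_0[OF lin] f0 subspace_0[OF U] by simp
  next
    case (step c x y)
    then have "x \<in> U" "y \<in> U" "scale c x \<in> U"
      using B(1) step subspace_scale[OF U] by auto
    then show ?case
      using f step linear_add[OF lin] linear_scale[OF lin] construct_basis[OF B(2) step(1)]
        subspace_add[OF U]
      by (simp add: linear_on_def)
  qed
  with that lin spanB show ?thesis by blast
qed

text \<open>
  A set \<open>S\<close> is adapted to a subspace \<open>V\<close> if \<open>S \<inter> V\<close> spans \<open>span S \<inter> V\<close>. Adaptedness to
  a step of the filtration is what keeps the rest of \<open>S\<close> independent of a basis of that step that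
  contains \<open>S \<inter> V\<close>, so the extension can be made from the bottom step upwards.
\<close>

lemma adapted_basis_extension:
  fixes V :: "nat \<Rightarrow> 'b set"
  assumes sub: "\<And>j. j \<le> m \<Longrightarrow> subspace (V j)" and chain: "\<And>j. j < m \<Longrightarrow> V j \<subseteq> V (Suc j)"
    and S: "independent S" and adapted: "\<And>j. j \<le> m \<Longrightarrow> span S \<inter> V j \<subseteq> span (S \<inter> V j)"
  shows "\<exists>E. S \<inter> V m \<subseteq> E \<and> independent E \<and> span E = V m \<and> (\<forall>j\<le>m. V j \<subseteq> span (E \<inter> V j))"
  using sub chain adapted
proof (induction m)
  case 0
  obtain E where E: "S \<inter> V 0 \<subseteq> E" "E \<subseteq> V 0" "independent E" "V 0 \<subseteq> span E"
    using maximal_independent_subset_extend[of "S \<inter> V 0" "V 0"] independent_mono[OF S, of "S \<inter> V 0"] by blast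
  moreover have "span E = V 0"
    using E 0(1) by (metis le_refl span_subspace)
  ultimately show ?case
    by (intro exI[of _ E]) (auto simp: Int_absorb2)
next
  case (Suc m)
  have "\<exists>E. S \<inter> V m \<subseteq> E \<and> independent E \<and> span E = V m \<and> (\<forall>j\<le>m. V j \<subseteq> span (E \<inter> V j))"
    by (rule Suc.IH) (use Suc.prems in auto)
  then obtain E where E: "S \<inter> V m \<subseteq> E" "independent E" "span E = V m"
      "\<And>j. j \<le> m \<Longrightarrow> V j \<subseteq> span (E \<inter> V j)"
    by blast
  let ?S = "S \<inter> V (Suc m)"
  have E_sub: "E \<subseteq> V (Suc m)"
    using E(3) span_superset[of E] Suc.prems(2)[of m] by blast
  have "span E \<inter> span (?S - E) \<subseteq> {0}"
  proof
    fix v assume v: "v \<in> span E \<inter> span (?S - E)"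
    then have "v \<in> span S \<inter> V m"
      using span_mono[of "?S - E" S] E(3) by blast
    then have "v \<in> span (S \<inter> V m)"
      using Suc.prems(3)[of m] by auto
    moreover have "span (S \<inter> V m) \<inter> span (?S - E) \<subseteq> {0}"
    proof (rule span_Int_disjoint_independent)
      show "independent ((S \<inter> V m) \<union> (?S - E))"
        by (rule independent_mono[OF S]) auto
    qed (use E(1) in auto)
    ultimately show "v \<in> {0}" using v by blast
  qed
  then have "independent (E \<union> (?S - E))"
    by (intro independent_Un_span_Int E(2) independent_mono[OF S]) auto
  then obtain E' where E': "E \<union> (?S - E) \<subseteq> E'" "E' \<subseteq> V (Suc m)" "independent E'" "V (Suc m) \<subseteq> span E'"
    using maximal_independent_subset_extend[of "E \<union> (?S - E)" "V (Suc m)"] E_sub by blast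
  have "V j \<subseteq> span (E' \<inter> V j)" if "j \<le> Suc m" for j
  proof (cases "j = Suc m")
    case True
    then show ?thesis using E' by (simp add: Int_absorb2)
  next
    case False
    then have "V j \<subseteq> span (E \<inter> V j)" using E(4) that by simp
    also have "\<dots> \<subseteq> span (E' \<inter> V j)" by (rule span_mono) (use E'(1) in blast)
    finally show ?thesis .
  qed
  moreover have "span E' = V (Suc m)"
    using E' Suc.prems(1)[of "Suc m"] by (metis le_refl span_subspace)
  ultimately show ?case
    using E' by (intro exI[of _ E']) auto
qed

text \<open>
  The step by which a basis travels along an arrow: the images of the surviving basis vectors keep
  their labels, and the vectors added to reach a basis start new orbits, tagged with the fresh
  vertex \<open>x\<close>.
\<close>

lemma labelled_basis_extension:
  fixes V :: "nat \<Rightarrow> 'b set" and l :: "'b \<Rightarrow> 'i \<times> 'b"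
  assumes f: "Vector_Spaces.linear scale scale f"
    and A: "independent A" "inj_on f (span A)" "f ` A \<subseteq> V m"
    and sub: "\<And>j. j \<le> m \<Longrightarrow> subspace (V j)" and chain: "\<And>j. j < m \<Longrightarrow> V j \<subseteq> V (Suc j)"
    and adapted: "\<And>j. j \<le> m \<Longrightarrow> span (f ` A) \<inter> V j \<subseteq> span (f ` A \<inter> V j)"
    and l: "inj l" "x \<notin> range (fst \<circ> l)"
  obtains E l' where "independent E" "span E = V m" "\<And>j. j \<le> m \<Longrightarrow> V j \<subseteq> span (E \<inter> V j)"
    "inj l'" "range (fst \<circ> l') \<subseteq> insert x (range (fst \<circ> l))"
    "\<And>a. a \<in> A \<Longrightarrow> f a \<in> E \<and> l' (f a) = l a"
proof -
  interpret vector_space_pair scale scale by unfold_locales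
  have "independent (f ` A)"
    by (rule linear_independent_injective_image) fact+
  then obtain E where E: "f ` A \<inter> V m \<subseteq> E" "independent E" "span E = V m"
      "\<forall>j\<le>m. V j \<subseteq> span (E \<inter> V j)"
    using adapted_basis_extension[of m V "f ` A"] sub chain adapted by blast
  have "inj_on f A" "inj_on l A"
    using A(2) l(1) span_superset[of A] by (auto intro: inj_on_subset)
  moreover have "fst (l a) \<noteq> x" for a
    using l(2) by auto
  ultimately obtain l' where "inj l'" "\<And>a. a \<in> A \<Longrightarrow> l' (f a) = l a"
      "range (fst \<circ> l') \<subseteq> insert x (range (fst \<circ> l))"
    using transport_labels[of f A l x] by metis
  then show ?thesis
    using that[of E l'] E A(3) by blast
qed

text \<open>
  By independence, a kernel inside the span of \<open>E \<inter> K\<close> meets the span of the other basis vectors only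
  in \<open>0\<close>. Along the chain \<open>K\<close> is the kernel itself, at the vertex \<open>3\<close> it is \<open>L\<close>.
\<close>

lemma inj_on_span_off_kernel:
  assumes f: "Vector_Spaces.linear scale scale f" and E: "independent E"
    and ker: "{v \<in> span E. f v = 0} \<subseteq> span (E \<inter> K)"
  shows "inj_on f (span (E - K))"
proof -
  interpret vector_space_pair scale scale by unfold_locales
  have "v = 0" if v: "v \<in> span (E - K)" "f v = 0" for v
  proof -
    have "v \<in> span (E \<inter> K)"
      using v ker span_mono[of "E - K" E] by blast
    moreover have "span (E - K) \<inter> span (E \<inter> K) \<subseteq> {0}"
    proof (rule span_Int_disjoint_independent)
      show "independent ((E - K) \<union> (E \<inter> K))"
        by (rule independent_mono[OF E]) auto
    qed auto
    ultimately show ?thesis using v by blast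
  qed
  then show ?thesis
    using linear_inj_on_iff_eq_0[OF f subspace_span] by blast
qed

section \<open>Bases along the chain and at the sinks\<close>

text \<open>
  The bases are built from the far end \<open>m\<close> of the chain down to \<open>0\<close>. The labels \<open>l k\<close> are injective
  and constant along the arrows, hence a basis vector has at most one preimage among the basis
  vectors. The offset \<open>c\<close> is the name of the vertex at position \<open>0\<close>, so that first components of
  labels are true vertices.
\<close>

lemma chain_basis:
  fixes U V :: "nat \<Rightarrow> 'b set" and f :: "nat \<Rightarrow> 'b \<Rightarrow> 'b"
  assumes lin: "\<And>k. k < m \<Longrightarrow> Vector_Spaces.linear scale scale (f k)"
    and maps: "\<And>k. k < m \<Longrightarrow> f k ` U (Suc k) \<subseteq> U k"
    and U: "\<And>k. k \<le> m \<Longrightarrow> subspace (U k)"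
    and V: "\<And>j. subspace (V j)" "\<And>j. V j \<subseteq> V (Suc j)" "V 0 = {0}" "V r = U 0"
  shows "\<exists>E (l :: nat \<Rightarrow> 'b \<Rightarrow> nat \<times> 'b).
    (\<forall>k\<in>{0..m}. independent (E k) \<and> span (E k) = U k \<and> inj (l k) \<and> range (fst \<circ> l k) \<subseteq> {c + k..} \<and>
      (\<forall>j\<le>k + r. pullback_filtration U f V k j \<subseteq> span (E k \<inter> pullback_filtration U f V k j))) \<and>
    (\<forall>k\<in>{0..<m}. \<forall>e\<in>E (Suc k). f k e = 0 \<or> f k e \<in> E k \<and> l k (f k e) = l (Suc k) e)"
proof -
  interpret vector_space_pair scale scale by unfold_locales
  let ?F = "pullback_filtration U f V"
  have F_sub: "subspace (?F k j)" if "k \<le> m" for k j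
    using that
  proof (induction k arbitrary: j)
    case (Suc k)
    show ?case
    proof (cases j)
      case (Suc j')
      have "?F (Suc k) j = U (Suc k) \<inter> {v. f k v \<in> ?F k j'}"
        using Suc by auto
      then show ?thesis
        using Suc.prems lin[of k] Suc.IH[of j'] U
        by (simp add: subspace_inter linear_subspace_linear_preimage)
    qed simp
  qed (simp add: V)
  have F_chain: "?F k j \<subseteq> ?F k (Suc j)" if "k \<le> m" for k j
    using that
  proof (induction k arbitrary: j)
    case (Suc k)
    then show ?case
      using F_sub[OF Suc.prems, of "Suc j"] by (cases j) (auto simp: subspace_0 dest: subspace_0)
  qed (simp add: V)
  have F_top: "?F k (k + r) = U k" if "k \<le> m" for k
    using that
  proof (induction k)
    case (Suc k)
    then show ?case using maps[of k] by auto
  qed (simp add: V)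
  have F_0: "?F k 0 = {0}" for k
    using V by (cases k) auto
  let ?P = "\<lambda>q E (l :: nat \<Rightarrow> 'b \<Rightarrow> nat \<times> 'b).
    (\<forall>k\<in>{q..m}. independent (E k) \<and> span (E k) = U k \<and> inj (l k) \<and> range (fst \<circ> l k) \<subseteq> {c + k..} \<and>
      (\<forall>j\<le>k + r. ?F k j \<subseteq> span (E k \<inter> ?F k j))) \<and>
    (\<forall>k\<in>{q..<m}. \<forall>e\<in>E (Suc k). f k e = 0 \<or> f k e \<in> E k \<and> l k (f k e) = l (Suc k) e)"
  have "\<exists>E l. ?P q E l" if "q \<le> m" for q
    using that
  proof (induction rule: inc_induct)
    case base
    obtain E where "independent E" "span E = ?F m (m + r)"
      "\<forall>j\<le>m + r. ?F m j \<subseteq> span (E \<inter> ?F m j)"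
      using adapted_basis_extension[of "m + r" "?F m" "{}"] F_sub F_chain independent_empty
      by (auto simp: subspace_0)
    then show ?case
      by (intro exI[of _ "\<lambda>_. E"] exI[of _ "\<lambda>_ e. (c + m, e)"]) (auto simp: F_top inj_def)
  next
    case (step q)
    from step.IH obtain E and l :: "nat \<Rightarrow> 'b \<Rightarrow> nat \<times> 'b" where El: "?P (Suc q) E l"
      by (elim exE)
    let ?D = "E (Suc q)" and ?K = "?F (Suc q) (Suc 0)"
    have q: "q < m" "q \<le> m" "Suc q \<le> m" using step by auto
    have El_basis: "independent (E k)" "span (E k) = U k" "inj (l k)" "range (fst \<circ> l k) \<subseteq> {c + k..}"
      "\<forall>j\<le>k + r. ?F k j \<subseteq> span (E k \<inter> ?F k j)" if "Suc q \<le> k" "k \<le> m" for k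
      using El[THEN conjunct1, rule_format, of k] that by simp_all
    have El_arrow: "f k e = 0 \<or> f k e \<in> E k \<and> l k (f k e) = l (Suc k) e"
      if "Suc q \<le> k" "k < m" "e \<in> E (Suc k)" for k e
      using El[THEN conjunct2, rule_format, of k e] that by simp
    note D = El_basis[OF le_refl q(3)]
    note linq = lin[OF q(1)]
    have K: "?K = {v \<in> U (Suc q). f q v = 0}"
      by (simp add: F_0)
    \<comment> \<open>Step \<open>1\<close> of the filtration is the kernel of \<open>f q\<close>, so exactly the basis vectors with
      nonzero image survive.\<close>
    have inj: "inj_on (f q) (span (?D - ?K))"
      by (rule inj_on_span_off_kernel[OF linq D(1)]) (use D(2) D(5)[rule_format, of 1] K in simp)
    have "?D \<subseteq> U (Suc q)"
      using D(2) span_superset by blast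
    then have im: "f q ` (?D - ?K) \<subseteq> ?F q (q + r)"
      using maps[OF q(1)] by (subst F_top[OF q(2)]) blast
    have adapted: "span (f q ` (?D - ?K)) \<inter> ?F q j \<subseteq> span (f q ` (?D - ?K) \<inter> ?F q j)"
      if j: "j \<le> q + r" for j
    proof
      fix v assume v: "v \<in> span (f q ` (?D - ?K)) \<inter> ?F q j"
      then obtain w where w: "w \<in> span (?D - ?K)" "v = f q w"
        using linear_span_image[OF linq, of "?D - ?K"] by auto
      \<comment> \<open>Steps of the filtration above \<open>0\<close> are full preimages, and the basis upstairs is adapted to
        them.\<close>
      then have "w \<in> ?F (Suc q) (Suc j)"
        using v span_mono[of "?D - ?K" ?D] D(2) by auto
      then have "w \<in> span (?D \<inter> ?F (Suc q) (Suc j))"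
        using D(5)[rule_format, of "Suc j"] j by auto
      then have "v \<in> span (f q ` (?D \<inter> ?F (Suc q) (Suc j)))"
        using w linear_span_image[OF linq] by simp
      also have "\<dots> \<subseteq> span (insert 0 (f q ` (?D - ?K) \<inter> ?F q j))"
        by (rule span_mono) (auto simp: F_0)
      finally show "v \<in> span (f q ` (?D - ?K) \<inter> ?F q j)" by simp
    qed
    have indep: "independent (?D - ?K)"
      by (rule independent_mono[OF D(1)]) auto
    have fresh: "c + q \<notin> range (fst \<circ> l (Suc q))"
      using D(4) by force
    obtain E' l' where E': "independent E'" "span E' = ?F q (q + r)"
        "\<And>j. j \<le> q + r \<Longrightarrow> ?F q j \<subseteq> span (E' \<inter> ?F q j)"
        "inj l'" "range (fst \<circ> l') \<subseteq> insert (c + q) (range (fst \<circ> l (Suc q)))"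
        "\<And>a. a \<in> ?D - ?K \<Longrightarrow> f q a \<in> E' \<and> l' (f q a) = l (Suc q) a"
      by (rule labelled_basis_extension[where V = "?F q" and m = "q + r", OF linq indep inj im
            F_sub[OF q(2)] F_chain[OF q(2)] adapted D(3) fresh]) (assumption, rule that)
    let ?E = "E(q := E')" and ?l = "l(q := l')"
    have "independent (?E k) \<and> span (?E k) = U k \<and> inj (?l k) \<and> range (fst \<circ> ?l k) \<subseteq> {c + k..} \<and>
        (\<forall>j\<le>k + r. ?F k j \<subseteq> span (?E k \<inter> ?F k j))" if k: "k \<in> {q..m}" for k
    proof (cases "k = q")
      case True
      have "insert (c + q) {c + Suc q..} \<subseteq> {c + q..}" by auto
      then have "range (fst \<circ> l') \<subseteq> {c + q..}"
        using E'(5) D(4) by blast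
      then show ?thesis using E'(1-4) F_top[OF q(2)] True by simp
    next
      case False
      then show ?thesis using El_basis[of k] k by simp
    qed
    moreover have "f k e = 0 \<or> f k e \<in> ?E k \<and> ?l k (f k e) = ?l (Suc k) e"
      if k: "k \<in> {q..<m}" and e: "e \<in> ?E (Suc k)" for k e
    proof (cases "k = q")
      case True
      have "e \<in> ?D" using e True by simp
      then have "f q e = 0 \<or> e \<in> ?D - ?K"
        using K by blast
      then show ?thesis using E'(6)[of e] True by auto
    next
      case False
      then show ?thesis using El_arrow[of k e] k e by simp
    qed
    ultimately have "?P q ?E ?l" by (intro conjI ballI allI impI) blast+
    then show ?case by (intro exI)
  qed
  from this[of 0] show ?thesis by simp
qed

text \<open>
  For the arrows into the vertices \<open>1\<close> and \<open>2\<close>, \<open>L\<close> is the sum of both kernels. The basis \<open>E\<close> is adapted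
  to \<open>L\<close> but perhaps not to the kernel of \<open>p\<close>, so within \<open>L\<close> the images of basis vectors may be
  dependent, and \<open>p ` L\<close> receives an unrelated basis. Outside \<open>L\<close> images of basis vectors are basis vectors, because
  \<open>p\<close> is injective on a complement of \<open>L\<close>, even modulo \<open>p ` L\<close>.
\<close>

lemma sink_basis:
  fixes l :: "'b \<Rightarrow> nat \<times> 'b"
  assumes p: "Vector_Spaces.linear scale scale p" and E: "independent E"
    and L: "subspace L" "L \<subseteq> span E" "L \<subseteq> span (E \<inter> L)" "{v \<in> span E. p v = 0} \<subseteq> L"
    and W: "subspace W" "p ` span E \<subseteq> W"
    and l: "inj l" "x \<notin> range (fst \<circ> l)"
  obtains E' and l' :: "'b \<Rightarrow> nat \<times> 'b" where "independent E'" "span E' = W"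
    "p ` L \<subseteq> span (E' \<inter> p ` L)" "inj l'"
    "\<And>e. e \<in> E - L \<Longrightarrow> p e \<in> E' \<and> p e \<notin> p ` L \<and> l' (p e) = l e"
proof -
  interpret vector_space_pair scale scale by unfold_locales
  let ?V = "\<lambda>j::nat. if j = 0 then p ` L else W"
  have inj: "inj_on p (span (E - L))"
    by (rule inj_on_span_off_kernel[OF p E]) (use L in blast)
  have lift: "v \<in> L" if v: "v \<in> span E" "p v \<in> p ` L" for v
  proof -
    obtain u where u: "u \<in> L" "p v = p u" using v(2) by blast
    then have "v - u \<in> {v \<in> span E. p v = 0}"
      using v(1) L(2) linear_diff[OF p] by (auto intro: span_diff)
    then have "v - u \<in> L" using L(4) by blast
    then have "(v - u) + u \<in> L" using u L(1) by (intro subspace_add)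
    then show ?thesis by simp
  qed
  have disj: "span (E - L) \<inter> L \<subseteq> {0}"
  proof -
    have "span (E - L) \<inter> span (E \<inter> L) \<subseteq> {0}"
    proof (rule span_Int_disjoint_independent)
      show "independent ((E - L) \<union> (E \<inter> L))"
        by (rule independent_mono[OF E]) auto
    qed auto
    then show ?thesis using L(3) by blast
  qed
  have adapted: "span (p ` (E - L)) \<inter> ?V j \<subseteq> span (p ` (E - L) \<inter> ?V j)" if "j \<le> 1" for j
  proof (cases "j = 0")
    case True
    have "span (p ` (E - L)) \<inter> p ` L \<subseteq> {0}"
    proof
      fix v assume v: "v \<in> span (p ` (E - L)) \<inter> p ` L"
      then obtain w where w: "w \<in> span (E - L)" "v = p w"
        using linear_span_image[OF p, of "E - L"] by auto
      then have "w \<in> L"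
        using lift[of w] v span_mono[of "E - L" E] by auto
      then have "w = 0" using w disj by blast
      then show "v \<in> {0}" using w linear_0[OF p] by simp
    qed
    then show ?thesis using True span_zero by auto
  next
    case False
    have "p ` (E - L) \<subseteq> W"
      using W(2) span_superset[of E] by blast
    then show ?thesis using False by (simp add: Int_absorb2)
  qed
  have indep: "independent (E - L)"
    by (rule independent_mono[OF E]) auto
  have im: "p ` (E - L) \<subseteq> ?V 1"
    using W(2) span_superset[of E] by auto
  have sub: "subspace (?V j)" for j
    using W L linear_subspace_image[OF p] by simp
  have chain: "?V j \<subseteq> ?V (Suc j)" for j
    using W L by auto
  obtain E' l' where E': "independent E'" "span E' = ?V 1"
      "\<And>j. j \<le> 1 \<Longrightarrow> ?V j \<subseteq> span (E' \<inter> ?V j)" "inj l'"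
      "\<And>a. a \<in> E - L \<Longrightarrow> p a \<in> E' \<and> l' (p a) = l a"
    by (rule labelled_basis_extension[where V = ?V and m = 1, OF p indep inj im sub chain adapted l])
      (assumption, rule that)
  have "p e \<notin> p ` L" if "e \<in> E - L" for e
    using lift[of e] that span_base by blast
  then show ?thesis
    using that[of E' l'] E'(1,2,4,5) E'(3)[of 0] by simp
qed

section \<open>Direct sums from labelled bases\<close>

text \<open>
  The isomorphism sends a vector to the family of its components along the labels, each component
  being the linear map that keeps the basis vectors of one label and kills all others. Naturality
  may then be checked on basis vectors, where it says that arrows respect labels.
\<close>

lemma direct_sum_of_labelled_basis:
  fixes M :: "'b rep" and g :: "nat \<times> nat \<Rightarrow> 'b \<Rightarrow> 'b" and lab :: "nat \<Rightarrow> 'b \<Rightarrow> 'j"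
  assumes n: "n \<ge> 3"
    and lin: "\<And>s t. (s, t) \<in> Q_arrows n \<Longrightarrow> Vector_Spaces.linear scale scale (g (s, t))"
    and agree: "\<And>s t v. (s, t) \<in> Q_arrows n \<Longrightarrow> v \<in> vspace M s \<Longrightarrow> g (s, t) v = arrow_map M (s, t) v"
    and E: "\<And>x. x \<in> Q_vertices n \<Longrightarrow> independent (E x)"
      "\<And>x. x \<in> Q_vertices n \<Longrightarrow> span (E x) = vspace M x"
    and arrows: "\<And>s t e. (s, t) \<in> Q_arrows n \<Longrightarrow> e \<in> E s \<Longrightarrow>
      g (s, t) e \<in> span {e' \<in> E t. lab t e' = lab s e}"
  defines "N \<equiv> \<lambda>j. \<lparr>vspace = \<lambda>x. span {e \<in> E x. lab x e = j}, arrow_map = g\<rparr>"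
  shows is_rep_label_summand: "is_rep scale n (N j)"
    and rep_isomorphic_label_summands: "rep_isomorphic scale (direct_sum_scale scale) n M (direct_sum UNIV N)"
proof -
  interpret vector_space_pair scale scale by unfold_locales
  have vertices: "s \<in> Q_vertices n" "t \<in> Q_vertices n" if "(s, t) \<in> Q_arrows n" for s t
    using that n by (auto simp: Q_arrows_def Q_vertices_def)
  have arrow_span: "g (s, t) v \<in> span {e \<in> E t. lab t e = j}"
    if st: "(s, t) \<in> Q_arrows n" and v: "v \<in> span {e \<in> E s. lab s e = j}" for s t v j
  proof -
    have "g (s, t) v \<in> span (g (s, t) ` {e \<in> E s. lab s e = j})"
      using linear_span_image[OF lin[OF st]] v by blast
    also have "\<dots> \<subseteq> span {e \<in> E t. lab t e = j}"
      by (rule span_minimal) (use arrows[OF st] in auto)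
    finally show ?thesis .
  qed
  show "is_rep scale n (N j)"
    using arrow_span lin
    by (auto simp: is_rep_def N_def linear_on_def linear_add linear_scale vector_space_axioms)

  define h where "h x v j = construct (E x) (\<lambda>e. if lab x e = j then e else 0) v" for x v j
  have h_linear: "Vector_Spaces.linear scale scale (\<lambda>v. h x v j)" if "x \<in> Q_vertices n" for x j
    unfolding h_def using linear_construct[OF E(1)[OF that]] by simp
  have h_basis: "h x e j = (if lab x e = j then e else 0)" if "x \<in> Q_vertices n" "e \<in> E x" for x e j
    unfolding h_def using construct_basis[OF E(1)[OF that(1)] that(2)] by simp
  have h_component: "h x v j = (if i = j then v else 0)"
    if x: "x \<in> Q_vertices n" and v: "v \<in> span {e \<in> E x. lab x e = i}" for x v i j
  proof (cases "i = j")
    case True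
    have "h x v j = id v"
      by (rule linear_eq_on[OF h_linear[OF x] linear_id v]) (use h_basis[OF x] True in auto)
    then show ?thesis using True by simp
  next
    case False
    have "h x v j = 0"
      by (rule linear_eq_0_on_span[OF h_linear[OF x] _ v]) (use h_basis[OF x] False in auto)
    then show ?thesis using False by simp
  qed
  have h_in: "h x v j \<in> span {e \<in> E x. lab x e = j}"
    if x: "x \<in> Q_vertices n" and v: "v \<in> vspace M x" for x v j
  proof -
    have "h x v j \<in> span ((\<lambda>e. h x e j) ` E x)"
      using linear_span_image[OF h_linear[OF x, of j], of "E x"] v E(2)[OF x] by blast
    also have "\<dots> \<subseteq> span {e \<in> E x. lab x e = j}"
      by (rule span_minimal) (auto simp: h_basis[OF x] span_zero intro: span_base)
    finally show ?thesis .
  qed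
  have h_sum: "\<exists>J. finite J \<and> {j. h x v j \<noteq> 0} \<subseteq> J \<and> v = (\<Sum>j\<in>J. h x v j)"
    if x: "x \<in> Q_vertices n" and v: "v \<in> vspace M x" for x v
  proof -
    obtain S c where S: "finite S" "S \<subseteq> E x" "v = (\<Sum>e\<in>S. scale (c e) e)"
      using v unfolding E(2)[OF x, symmetric] span_explicit by blast
    have hv: "h x v j = (\<Sum>e\<in>S. if lab x e = j then scale (c e) e else 0)" for j
      unfolding S(3) linear_sum[OF h_linear[OF x]] linear_scale[OF h_linear[OF x]]
      by (rule sum.cong) (use h_basis[OF x] S(2) in auto)
    have "(\<Sum>j\<in>lab x ` S. h x v j) = (\<Sum>e\<in>S. \<Sum>j\<in>lab x ` S. if lab x e = j then scale (c e) e else 0)"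
      unfolding hv by (rule sum.swap)
    also have "\<dots> = v"
      unfolding S(3) by (rule sum.cong) (use S(1) in \<open>simp_all add: sum.delta'\<close>)
    finally have "v = (\<Sum>j\<in>lab x ` S. h x v j)" by simp
    moreover have "{j. h x v j \<noteq> 0} \<subseteq> lab x ` S"
    proof
      fix j assume "j \<in> {j. h x v j \<noteq> 0}"
      then obtain e where "e \<in> S" "(if lab x e = j then scale (c e) e else 0) \<noteq> 0"
        unfolding hv by (auto elim!: sum.not_neutral_contains_not_neutral)
      then show "j \<in> lab x ` S" by (auto split: if_splits)
    qed
    ultimately show ?thesis using S(1) by blast
  qed
  have h_range: "h x v \<in> vspace (direct_sum UNIV N) x" if "x \<in> Q_vertices n" "v \<in> vspace M x" for x v
    using h_in[OF that] h_sum[OF that] by (auto simp: direct_sum_def N_def intro: finite_subset)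
  have bij: "bij_betw (h x) (vspace M x) (vspace (direct_sum UNIV N) x)" if x: "x \<in> Q_vertices n" for x
    unfolding bij_betw_def
  proof (intro conjI set_eqI iffI)
    show "inj_on (h x) (vspace M x)"
    proof (rule inj_onI)
      fix v w assume vw: "v \<in> vspace M x" "w \<in> vspace M x" and eq: "h x v = h x w"
      have "v - w \<in> vspace M x"
        using vw unfolding E(2)[OF x, symmetric] by (rule span_diff)
      then obtain J where "v - w = (\<Sum>j\<in>J. h x (v - w) j)"
        using h_sum[OF x] by blast
      also have "\<dots> = 0"
        using linear_diff[OF h_linear[OF x]] eq by simp
      finally show "v = w" by simp
    qed
  next
    fix f assume "f \<in> h x ` vspace M x"
    then show "f \<in> vspace (direct_sum UNIV N) x" using h_range[OF x] by blast
  next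
    fix f assume "f \<in> vspace (direct_sum UNIV N) x"
    then have f: "finite {j. f j \<noteq> 0}" "\<And>j. f j \<in> span {e \<in> E x. lab x e = j}"
      by (auto simp: direct_sum_def N_def)
    let ?v = "\<Sum>i | f i \<noteq> 0. f i"
    have "h x ?v j = f j" for j
    proof -
      have "h x ?v j = (\<Sum>i | f i \<noteq> 0. if i = j then f i else 0)"
        unfolding linear_sum[OF h_linear[OF x]] using h_component[OF x f(2)] by simp
      then show ?thesis using f(1) by simp
    qed
    then have "h x ?v = f" by auto
    moreover have "?v \<in> vspace M x"
      unfolding E(2)[OF x, symmetric]
      by (rule span_sum) (use f(2) span_mono[of "{e \<in> E x. lab x e = j}" "E x" for j] in blast)
    ultimately show "f \<in> h x ` vspace M x" by (rule image_eqI[OF sym])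
  qed
  have natural: "h t (arrow_map M (s, t) v) = arrow_map (direct_sum UNIV N) (s, t) (h s v)"
    if st: "(s, t) \<in> Q_arrows n" and v: "v \<in> vspace M s" for s t v
  proof
    fix j
    note vt = vertices[OF st]
    have "v \<in> span (E s)" using v E(2)[OF vt(1)] by simp
    then have "h t (g (s, t) v) j = g (s, t) (h s v j)"
    proof (rule linear_eq_on[rotated 2])
      show "Vector_Spaces.linear scale scale (\<lambda>v. h t (g (s, t) v) j)"
        "Vector_Spaces.linear scale scale (\<lambda>v. g (s, t) (h s v j))"
        using Vector_Spaces.linear_compose[OF lin[OF st] h_linear[OF vt(2), of j]]
          Vector_Spaces.linear_compose[OF h_linear[OF vt(1), of j] lin[OF st]]
        by (simp_all add: o_def)
      show "h t (g (s, t) e) j = g (s, t) (h s e j)" if "e \<in> E s" for e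
        using h_component[OF vt(2) arrows[OF st that]] h_basis[OF vt(1) that] linear_0[OF lin[OF st]]
        by auto
    qed
    then show "h t (arrow_map M (s, t) v) j = arrow_map (direct_sum UNIV N) (s, t) (h s v) j"
      using agree[OF st v] by (simp add: direct_sum_def N_def)
  qed
  have "linear_on scale (direct_sum_scale scale) (vspace M x) (vspace (direct_sum UNIV N) x) (h x)"
    if x: "x \<in> Q_vertices n" for x
    using h_range[OF x] linear_add[OF h_linear[OF x]] linear_scale[OF h_linear[OF x]]
    by (auto simp: linear_on_def direct_sum_scale_def fun_eq_iff)
  then show "rep_isomorphic scale (direct_sum_scale scale) n M (direct_sum UNIV N)"
    unfolding rep_isomorphic_def using bij natural by (intro exI[of _ h]) auto
qed

section \<open>The labelled basis of a representation\<close>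

text \<open>
  This is where the bijective summand comes from. Modulo the kernels, \<open>p\<close> sees only the \<open>K2\<close>-part of
  a vector of \<open>L\<close> and \<open>q\<close> only its \<open>K1\<close>-part, so the two images can be prescribed independently.
\<close>

lemma bij_betw_kernel_sum_complement:
  fixes p q :: "'b \<Rightarrow> 'b" and U :: "'b set"
  defines "K1 \<equiv> {v \<in> U. p v = 0}" and "K2 \<equiv> {v \<in> U. q v = 0}"
  assumes p: "Vector_Spaces.linear scale scale p" and q: "Vector_Spaces.linear scale scale q"
    and L: "L = {u + v | u v. u \<in> K1 \<and> v \<in> K2}" "subspace L" "K1 \<subseteq> L" "K2 \<subseteq> L" "L \<subseteq> U"
    and A: "subspace A" "A \<subseteq> L" "A \<inter> (K1 \<inter> K2) \<subseteq> {0}" "L \<subseteq> {a + b | a b. a \<in> A \<and> b \<in> K1 \<inter> K2}"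
  shows "bij_betw (\<lambda>v. (p v, q v)) A (p ` L \<times> q ` L)"
proof -
  interpret vector_space_pair scale scale by unfold_locales
  show ?thesis
    unfolding bij_betw_def
  proof (intro conjI equalityI subsetI)
    show "inj_on (\<lambda>v. (p v, q v)) A"
    proof (rule inj_onI)
      fix v w assume vw: "v \<in> A" "w \<in> A" "(p v, q v) = (p w, q w)"
      then have "v - w \<in> A" using A(1) by (intro subspace_diff)
      moreover from this have "v - w \<in> K1 \<inter> K2"
        using vw(3) A(2) L(5) linear_diff[OF p] linear_diff[OF q] by (auto simp: K1_def K2_def)
      ultimately show "v = w" using A(3) by auto
    qed
  next
    fix z assume "z \<in> (\<lambda>v. (p v, q v)) ` A"
    then show "z \<in> p ` L \<times> q ` L" using A(2) by auto
  next
    fix z assume "z \<in> p ` L \<times> q ` L"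
    then obtain u v where z: "z = (p u, q v)" "u \<in> L" "v \<in> L" by auto
    then obtain u1 u2 v1 v2 where uv: "u = u1 + u2" "u1 \<in> K1" "u2 \<in> K2" "v = v1 + v2" "v1 \<in> K1" "v2 \<in> K2"
      unfolding L(1) by blast
    then have "u2 + v1 \<in> L" using L(3,4) subspace_add[OF L(2)] by blast
    then obtain a b where ab: "u2 + v1 = a + b" "a \<in> A" "b \<in> K1 \<inter> K2"
      using A(4) by blast
    have "p a = p (u2 + v1)" "q a = q (u2 + v1)"
      using ab(3) by (simp_all add: ab(1) linear_add[OF p] linear_add[OF q] K1_def K2_def)
    then have "(p a, q a) = z"
      using uv by (simp add: z linear_add[OF p] linear_add[OF q] K1_def K2_def)
    then show "z \<in> (\<lambda>v. (p v, q v)) ` A" using ab(2) by blast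
  qed
qed

text \<open>
  The label \<open>None\<close> marks the summand on which \<open>(\<pi>\<^sub>1, \<pi>\<^sub>2)\<close> is bijective. At a vertex of the chain it is
  given to the basis vectors whose image at the vertex \<open>3\<close> lies in \<open>L\<close> but not in \<open>X\<close>; being
  defined through the image at \<open>3\<close>, it is constant along the chain.
\<close>

lemma labelled_basis_exists:
  fixes U :: "nat \<Rightarrow> 'b set" and g :: "nat \<times> nat \<Rightarrow> 'b \<Rightarrow> 'b"
  assumes n: "n \<ge> 3"
    and sub: "\<And>x. x \<in> Q_vertices n \<Longrightarrow> subspace (U x)"
    and lin: "\<And>s t. (s, t) \<in> Q_arrows n \<Longrightarrow> Vector_Spaces.linear scale scale (g (s, t))"
    and maps: "\<And>s t. (s, t) \<in> Q_arrows n \<Longrightarrow> g (s, t) ` U s \<subseteq> U t"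
  obtains E and lab :: "nat \<Rightarrow> 'b \<Rightarrow> (nat \<times> 'b) option" where
    "\<And>x. x \<in> Q_vertices n \<Longrightarrow> independent (E x)"
    "\<And>x. x \<in> Q_vertices n \<Longrightarrow> span (E x) = U x"
    "\<And>x e e' i. x \<in> Q_vertices n \<Longrightarrow> lab x e = Some i \<Longrightarrow> lab x e' = Some i \<Longrightarrow> e = e'"
    "\<And>s t e. (s, t) \<in> Q_arrows n \<Longrightarrow> e \<in> E s \<Longrightarrow> g (s, t) e \<in> span {e' \<in> E t. lab t e' = lab s e}"
    "bij_betw (\<lambda>v. (g (3, 1) v, g (3, 2) v)) (span {e \<in> E 3. lab 3 e = None})
       (span {e \<in> E 1. lab 1 e = None} \<times> span {e \<in> E 2. lab 2 e = None})"
proof -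
  interpret vector_space_pair scale scale by unfold_locales
  have a31: "(3, 1) \<in> Q_arrows n" and a32: "(3, 2) \<in> Q_arrows n"
    by (auto simp: Q_arrows_def)
  have achain: "(k + 4, k + 3) \<in> Q_arrows n" if "k < n - 3" for k
    using that by (auto simp: Q_arrows_def intro!: exI[of _ "k + 3"])
  have verts: "1 \<in> Q_vertices n" "2 \<in> Q_vertices n" "3 \<in> Q_vertices n"
    using n by (auto simp: Q_vertices_def)

  define p q where "p = g (3, 1)" and "q = g (3, 2)"
  have p: "Vector_Spaces.linear scale scale p" and q: "Vector_Spaces.linear scale scale q"
    using lin a31 a32 by (simp_all add: p_def q_def)
  define U3 where "U3 = U 3"
  have U3: "subspace U3" using sub verts by (simp add: U3_def)
  define K1 where "K1 = {v \<in> U3. p v = 0}"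
  define K2 where "K2 = {v \<in> U3. q v = 0}"
  have "K1 = U3 \<inter> {v. p v \<in> {0}}" "K2 = U3 \<inter> {v. q v \<in> {0}}"
    by (auto simp: K1_def K2_def)
  then have K: "subspace K1" "subspace K2"
    using U3 linear_subspace_linear_preimage[OF p subspace_single_0]
      linear_subspace_linear_preimage[OF q subspace_single_0] by (simp_all add: subspace_inter)
  define X where "X = K1 \<inter> K2"
  define L where "L = {u + v | u v. u \<in> K1 \<and> v \<in> K2}"
  have X: "subspace X" and L: "subspace L"
    using K by (simp_all add: X_def L_def subspace_inter subspace_sums)
  have K1_L: "K1 \<subseteq> L"
  proof
    fix v assume "v \<in> K1"
    moreover have "v = v + 0" by simp
    ultimately show "v \<in> L" using subspace_0[OF K(2)] unfolding L_def by blast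
  qed
  have K2_L: "K2 \<subseteq> L"
  proof
    fix v assume "v \<in> K2"
    moreover have "v = 0 + v" by simp
    ultimately show "v \<in> L" using subspace_0[OF K(1)] unfolding L_def by blast
  qed
  have L_U3: "L \<subseteq> U3"
    using subspace_add[OF U3] by (auto simp: L_def K1_def K2_def)
  have X_L: "X \<subseteq> L" using K1_L by (auto simp: X_def)

  \<comment> \<open>Constant from \<open>3\<close> on, as the pulled back filtrations are indexed by all natural numbers.\<close>
  define V where "V j = (if j = 0 then {0} else if j = 1 then X else if j = 2 then L else U3)" for j :: nat
  have V: "subspace (V j)" "V j \<subseteq> V (Suc j)" for j
    using X L U3 X_L L_U3 subspace_0[OF X] by (auto simp: V_def)
  have V_ends: "V 0 = {0}" "V 3 = U (0 + 3)"
    by (simp_all add: V_def U3_def)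
  have "\<exists>E (l :: nat \<Rightarrow> 'b \<Rightarrow> nat \<times> 'b).
    (\<forall>k\<in>{0..n - 3}. independent (E k) \<and> span (E k) = U (k + 3) \<and> inj (l k) \<and>
      range (fst \<circ> l k) \<subseteq> {3 + k..} \<and>
      (\<forall>j\<le>k + 3. pullback_filtration (\<lambda>k. U (k + 3)) (\<lambda>k. g (k + 4, k + 3)) V k j \<subseteq>
        span (E k \<inter> pullback_filtration (\<lambda>k. U (k + 3)) (\<lambda>k. g (k + 4, k + 3)) V k j))) \<and>
    (\<forall>k\<in>{0..<n - 3}. \<forall>e\<in>E (Suc k). g (k + 4, k + 3) e = 0 \<or>
      g (k + 4, k + 3) e \<in> E k \<and> l k (g (k + 4, k + 3) e) = l (Suc k) e)"
  proof (rule chain_basis)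
    fix k assume k: "k < n - 3"
    show "Vector_Spaces.linear scale scale (g (k + 4, k + 3))"
      by (rule lin[OF achain[OF k]])
    show "g (k + 4, k + 3) ` U (Suc k + 3) \<subseteq> U (k + 3)"
      using maps[OF achain[OF k]] by (simp add: eval_nat_numeral)
  next
    fix k assume "k \<le> n - 3"
    then show "subspace (U (k + 3))"
      using n by (intro sub) (auto simp: Q_vertices_def)
  qed (use V V_ends in auto)
  \<comment> \<open>Position \<open>k\<close> of the chain is the vertex \<open>k + 3\<close>.\<close>
  then obtain D and l :: "nat \<Rightarrow> 'b \<Rightarrow> nat \<times> 'b" where Dl1:
      "\<forall>k\<in>{0..n - 3}. independent (D k) \<and> span (D k) = U (k + 3) \<and> inj (l k) \<and>
        range (fst \<circ> l k) \<subseteq> {3 + k..} \<and>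
        (\<forall>j\<le>k + 3. pullback_filtration (\<lambda>k. U (k + 3)) (\<lambda>k. g (k + 4, k + 3)) V k j \<subseteq>
          span (D k \<inter> pullback_filtration (\<lambda>k. U (k + 3)) (\<lambda>k. g (k + 4, k + 3)) V k j))"
    and Dl2: "\<forall>k\<in>{0..<n - 3}. \<forall>e\<in>D (Suc k). g (k + 4, k + 3) e = 0 \<or>
        g (k + 4, k + 3) e \<in> D k \<and> l k (g (k + 4, k + 3) e) = l (Suc k) e"
    by (elim exE conjE)
  have D_basis: "independent (D k)" "span (D k) = U (k + 3)" "inj (l k)" if "k \<le> n - 3" for k
    using Dl1[rule_format, of k] that by simp_all
  have D_arrow: "g (k + 4, k + 3) e = 0 \<or> g (k + 4, k + 3) e \<in> D k \<and> l k (g (k + 4, k + 3) e) = l (Suc k) e"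
    if "k < n - 3" "e \<in> D (Suc k)" for k e
    using Dl2[rule_format, of k e] that by simp
  let ?D = "D 0"
  have D: "independent ?D" "span ?D = U3" "inj (l 0)"
    using D_basis[of 0] by (simp_all add: U3_def)
  have D_adapted: "V j \<subseteq> span (?D \<inter> V j)" if "j \<le> 3" for j
    using Dl1[rule_format, of 0] that by simp
  have D_X: "X \<subseteq> span (?D \<inter> X)" and D_L: "L \<subseteq> span (?D \<inter> L)"
    using D_adapted[of 1] D_adapted[of 2] by (simp_all add: V_def)
  have tags: "range (fst \<circ> l 0) \<subseteq> {3..}"
    using Dl1[rule_format, of 0] by simp
  have fresh: "1 \<notin> range (fst \<circ> l 0)" "2 \<notin> range (fst \<circ> l 0)"
    using subsetD[OF tags, of 1] subsetD[OF tags, of 2] by auto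
  have p_U3: "p ` span ?D \<subseteq> U 1" and q_U3: "q ` span ?D \<subseteq> U 2"
    using maps[OF a31] maps[OF a32] by (simp_all add: D U3_def p_def q_def)
  obtain E1 and l1 :: "'b \<Rightarrow> nat \<times> 'b" where E1: "independent E1" "span E1 = U 1"
    "p ` L \<subseteq> span (E1 \<inter> p ` L)" "inj l1"
    "\<And>e. e \<in> ?D - L \<Longrightarrow> p e \<in> E1 \<and> p e \<notin> p ` L \<and> l1 (p e) = l 0 e"
    by (rule sink_basis[OF p D(1) L _ D_L _ sub[OF verts(1)] p_U3 D(3) fresh(1)])
      (use K1_L L_U3 D(2) in \<open>simp_all add: K1_def\<close>)
  obtain E2 and l2 :: "'b \<Rightarrow> nat \<times> 'b" where E2: "independent E2" "span E2 = U 2"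
    "q ` L \<subseteq> span (E2 \<inter> q ` L)" "inj l2"
    "\<And>e. e \<in> ?D - L \<Longrightarrow> q e \<in> E2 \<and> q e \<notin> q ` L \<and> l2 (q e) = l 0 e"
    by (rule sink_basis[OF q D(1) L _ D_L _ sub[OF verts(2)] q_U3 D(3) fresh(2)])
      (use K2_L L_U3 D(2) in \<open>simp_all add: K2_def\<close>)

  \<comment> \<open>The composite map from the vertex \<open>k + 3\<close> to the vertex \<open>3\<close>.\<close>
  define path where "path = rec_nat id (\<lambda>k r. r \<circ> g (k + 4, k + 3))"
  have path: "path 0 = id" "path (Suc k) = path k \<circ> g (k + 4, k + 3)" for k
    by (simp_all add: path_def)
  define E where "E x = (if x = 1 then E1 else if x = 2 then E2 else D (x - 3))" for x
  define lab where "lab x e =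
     (if x = 1 then if e \<in> p ` L then None else Some (l1 e)
      else if x = 2 then if e \<in> q ` L then None else Some (l2 e)
      else if path (x - 3) e \<in> L - X then None else Some (l (x - 3) e))" for x e
  have E_basis: "independent (E x)" "span (E x) = U x" if "x \<in> Q_vertices n" for x
    using that E1(1,2) E2(1,2) D_basis(1,2)[of "x - 3", OF diff_le_mono] by (auto simp: E_def Q_vertices_def)
  have lab_inj: "e = e'" if "x \<in> Q_vertices n" "lab x e = Some i" "lab x e' = Some i" for x e e' i
    using that E1(4) E2(4) D_basis(3)[of "x - 3", OF diff_le_mono]
    by (auto simp: lab_def Q_vertices_def split: if_splits dest: injD)
  have sink_arrow: "r e \<in> span {e' \<in> F. (if e' \<in> r ` L then None else Some (l' e')) = lab 3 e}"
    if e: "e \<in> ?D" and X0: "\<And>v. v \<in> X \<Longrightarrow> r v = 0" and rL: "r ` L \<subseteq> span (F \<inter> r ` L)"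
      and off_L: "\<And>e. e \<in> ?D - L \<Longrightarrow> r e \<in> F \<and> r e \<notin> r ` L \<and> l' (r e) = l 0 e"
    for r :: "'b \<Rightarrow> 'b" and F l' e
  proof -
    consider "e \<in> X" | "e \<in> L - X" | "e \<in> ?D - L" using e by blast
    then show ?thesis
    proof cases
      case 1
      then show ?thesis using X0 by (simp add: span_zero)
    next
      case 2
      then have "r e \<in> span (F \<inter> r ` L)" using rL by blast
      also have "F \<inter> r ` L = {e' \<in> F. (if e' \<in> r ` L then None else Some (l' e')) = lab 3 e}"
        using 2 by (auto simp: lab_def path)
      finally show ?thesis .
    next
      case 3
      then show ?thesis using off_L[OF 3] by (intro span_base) (simp add: lab_def path)
    qed
  qed
  have arrows: "g (s, t) e \<in> span {e' \<in> E t. lab t e' = lab s e}"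
    if st: "(s, t) \<in> Q_arrows n" and e: "e \<in> E s" for s t e
  proof -
    consider "s = 3" "t = 1" | "s = 3" "t = 2" | k where "k < n - 3" "s = k + 4" "t = k + 3"
    proof -
      consider "s = 3" "t = 1" | "s = 3" "t = 2" | i where "s = i + 1" "t = i" "3 \<le> i" "i \<le> n - 1"
        using st unfolding Q_arrows_def by auto
      then show ?thesis
      proof cases
        case (3 i)
        then show ?thesis using that(3)[of "i - 3"] n by auto
      qed (use that in auto)
    qed
    then show ?thesis
    proof cases
      case 1
      then show ?thesis
        using sink_arrow[of e p E1 l1] e E1(3,5) by (simp add: E_def lab_def p_def X_def K1_def)
    next
      case 2
      then show ?thesis
        using sink_arrow[of e q E2 l2] e E2(3,5) by (simp add: E_def lab_def q_def X_def K2_def)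
    next
      case 3
      have "e \<in> D (Suc k)" using e 3 by (simp add: E_def eval_nat_numeral)
      then consider "g (s, t) e = 0" | "g (s, t) e \<in> D k" "l k (g (s, t) e) = l (Suc k) e"
        using D_arrow[OF 3(1)] 3 by blast
      then show ?thesis
      proof cases
        assume "g (s, t) e = 0"
        then show ?thesis by (simp add: span_zero)
      next
        assume "g (s, t) e \<in> D k" "l k (g (s, t) e) = l (Suc k) e"
        moreover have "s - 3 = Suc k" "t - 3 = k" "s \<noteq> 1" "s \<noteq> 2" "t \<noteq> 1" "t \<noteq> 2"
          using 3 by auto
        moreover have "path (Suc k) e = path k (g (s, t) e)"
          using 3 by (simp add: path)
        ultimately show ?thesis
          by (intro span_base) (simp add: E_def lab_def)
      qed
    qed
  qed

  let ?A = "?D \<inter> (L - X)"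
  have E3: "{e \<in> E 3. lab 3 e = None} = ?A"
    by (auto simp: E_def lab_def path)
  have E1_None: "span {e \<in> E 1. lab 1 e = None} = p ` L"
  proof -
    have "span (E1 \<inter> p ` L) = p ` L"
      using E1(3) linear_subspace_image[OF p L] by (metis inf.cobounded2 span_subspace)
    moreover have "{e \<in> E 1. lab 1 e = None} = E1 \<inter> p ` L"
      by (auto simp: E_def lab_def)
    ultimately show ?thesis by simp
  qed
  have E2_None: "span {e \<in> E 2. lab 2 e = None} = q ` L"
  proof -
    have "span (E2 \<inter> q ` L) = q ` L"
      using E2(3) linear_subspace_image[OF q L] by (metis inf.cobounded2 span_subspace)
    moreover have "{e \<in> E 2. lab 2 e = None} = E2 \<inter> q ` L"
      by (auto simp: E_def lab_def)
    ultimately show ?thesis by simp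
  qed
  have "bij_betw (\<lambda>v. (p v, q v)) (span ?A) (p ` L \<times> q ` L)"
  proof (rule bij_betw_kernel_sum_complement[OF p q, where U = U3])
    show "span ?A \<subseteq> L"
      by (rule span_minimal) (use L in auto)
    have "span ?A \<inter> span (?D \<inter> X) \<subseteq> {0}"
    proof (rule span_Int_disjoint_independent)
      show "independent (?A \<union> (?D \<inter> X))"
        by (rule independent_mono[OF D(1)]) auto
    qed auto
    then show "span ?A \<inter> ({v \<in> U3. p v = 0} \<inter> {v \<in> U3. q v = 0}) \<subseteq> {0}"
      using D_X unfolding X_def K1_def K2_def by blast
    have "L \<subseteq> span (?A \<union> (?D \<inter> X))"
      using D_L span_mono[of "?D \<inter> L" "?A \<union> (?D \<inter> X)"] by blast
    moreover have "span (?D \<inter> X) \<subseteq> X"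
      by (rule span_minimal) (use X in auto)
    ultimately show "L \<subseteq> {a + b | a b. a \<in> span ?A \<and> b \<in> {v \<in> U3. p v = 0} \<inter> {v \<in> U3. q v = 0}}"
      unfolding span_Un X_def K1_def K2_def by blast
  qed (use L L_U3 K1_L K2_L in \<open>simp_all add: L_def K1_def K2_def\<close>)
  then have bij: "bij_betw (\<lambda>v. (g (3, 1) v, g (3, 2) v)) (span {e \<in> E 3. lab 3 e = None})
      (span {e \<in> E 1. lab 1 e = None} \<times> span {e \<in> E 2. lab 2 e = None})"
    unfolding E3 E1_None E2_None by (simp add: p_def q_def)
  show ?thesis
    by (rule that; fact E_basis lab_inj arrows bij)
qed

end

theorem theorem2p1:
  fixes scale :: "'k::field \<Rightarrow> 'v::ab_group_add \<Rightarrow> 'v"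
    and n :: nat and M :: "'v rep"
  assumes "n \<ge> 3"
    and "is_rep scale n M"
  shows "\<exists>(B :: 'v rep) (I :: (nat \<times> 'v) set) (T :: nat \<times> 'v \<Rightarrow> 'v rep).
           in_B_check scale n B \<and>
           (\<forall>i\<in>I. thin scale n (T i)) \<and>
           rep_isomorphic scale (direct_sum_scale scale) n M
             (direct_sum (insert None (Some ` I)) (case_option B T))"
proof -
  interpret vector_space scale
    using assms(2) by (simp add: is_rep_def)
  have sub: "subspace (vspace M x)" if "x \<in> Q_vertices n" for x
    using assms(2) that by (auto simp: is_rep_def)
  have M_lin: "linear_on scale scale (vspace M s) (vspace M t) (arrow_map M (s, t))"
    if "(s, t) \<in> Q_arrows n" for s t
    using assms(2) that by (auto simp: is_rep_def)
  have "\<forall>a\<in>Q_arrows n. \<exists>f. Vector_Spaces.linear scale scale f \<and>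
      (\<forall>v\<in>vspace M (fst a). f v = arrow_map M a v)"
  proof
    fix a assume a: "a \<in> Q_arrows n"
    then have "fst a \<in> Q_vertices n"
      using assms(1) by (auto simp: Q_arrows_def Q_vertices_def)
    moreover have "linear_on scale scale (vspace M (fst a)) (vspace M (snd a)) (arrow_map M a)"
      using M_lin[of "fst a" "snd a"] a by simp
    ultimately show "\<exists>f. Vector_Spaces.linear scale scale f \<and> (\<forall>v\<in>vspace M (fst a). f v = arrow_map M a v)"
      using linear_on_extension[OF _ sub] by metis
  qed
  then obtain g where g: "\<forall>a\<in>Q_arrows n. Vector_Spaces.linear scale scale (g a) \<and>
      (\<forall>v\<in>vspace M (fst a). g a v = arrow_map M a v)"
    by (rule bchoice[THEN exE])
  have lin: "Vector_Spaces.linear scale scale (g (s, t))" if "(s, t) \<in> Q_arrows n" for s t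
    using g that by blast
  have agree: "g (s, t) v = arrow_map M (s, t) v" if "(s, t) \<in> Q_arrows n" "v \<in> vspace M s" for s t v
    using g that by force
  have maps: "g (s, t) ` vspace M s \<subseteq> vspace M t" if "(s, t) \<in> Q_arrows n" for s t
    using M_lin[OF that] agree[OF that] by (auto simp: linear_on_def)
  obtain E and lab :: "nat \<Rightarrow> 'v \<Rightarrow> (nat \<times> 'v) option" where
    basis: "\<And>x. x \<in> Q_vertices n \<Longrightarrow> independent (E x)"
      "\<And>x. x \<in> Q_vertices n \<Longrightarrow> span (E x) = vspace M x"
    and lab_inj: "\<And>x e e' i. x \<in> Q_vertices n \<Longrightarrow> lab x e = Some i \<Longrightarrow> lab x e' = Some i \<Longrightarrow> e = e'"
    and arrows: "\<And>s t e. (s, t) \<in> Q_arrows n \<Longrightarrow> e \<in> E s \<Longrightarrow>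
      g (s, t) e \<in> span {e' \<in> E t. lab t e' = lab s e}"
    and bij: "bij_betw (\<lambda>v. (g (3, 1) v, g (3, 2) v)) (span {e \<in> E 3. lab 3 e = None})
       (span {e \<in> E 1. lab 1 e = None} \<times> span {e \<in> E 2. lab 2 e = None})"
    by (rule labelled_basis_exists[where U = "vspace M", OF assms(1) sub lin maps])
      (assumption+, rule that)
  \<comment> \<open>A pair that labels no basis vector gives the zero representation, which is thin; so all pairs
    serve as indices.\<close>
  define N where "N = (\<lambda>j. \<lparr>vspace = \<lambda>x. span {e \<in> E x. lab x e = j}, arrow_map = g\<rparr>)"
  have N_rep: "is_rep scale n (N j)" for j
    unfolding N_def by (rule is_rep_label_summand[OF assms(1) lin agree basis arrows])
  have iso: "rep_isomorphic scale (direct_sum_scale scale) n M (direct_sum UNIV N)"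
    unfolding N_def by (rule rep_isomorphic_label_summands[OF assms(1) lin agree basis arrows])
  have thin: "thin scale n (N (Some i))" for i
    unfolding thin_def
  proof (intro conjI ballI N_rep)
    fix x assume x: "x \<in> Q_vertices n"
    let ?B = "{e \<in> E x. lab x e = Some i}"
    have "\<exists>b. ?B \<subseteq> {b}"
      using lab_inj[OF x] by blast
    then obtain b where "?B \<subseteq> {b}" ..
    then have "finite ?B" "card ?B \<le> 1"
      using finite_subset[of ?B "{b}"] card_mono[of "{b}" ?B] by simp_all
    moreover have "independent ?B"
      by (rule independent_mono[OF basis(1)[OF x]]) auto
    ultimately show "\<exists>B. finite B \<and> card B \<le> 1 \<and> independent B \<and> span B = vspace (N (Some i)) x"
      by (intro exI[of _ ?B]) (simp add: N_def)
  qed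
  have "in_B_check scale n (N None)"
    unfolding in_B_check_def using bij N_rep by (simp add: N_def)
  moreover have "insert None (Some ` (UNIV :: (nat \<times> 'v) set)) = UNIV"
    by (rule UNIV_option_conv[symmetric])
  moreover have "case_option (N None) (\<lambda>i. N (Some i)) = N"
    by (auto simp: fun_eq_iff split: option.split)
  ultimately show ?thesis
    using thin iso by (intro exI[of _ "N None"] exI[of _ UNIV] exI[of _ "\<lambda>i. N (Some i)"]) simp
qed

end
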